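(* For each integer $n\ge 11$ there are at least $2^{\lfloor\frac{n-11}{2}\rfloor}$ pairwise non-isomorphic 2-connected planar graphs in $S_n$.
   Context: All graphs are finite and simple. $\chi(G)$ is the chromatic number and $\Delta(G)$ the maximum degree of $G$. ${\rm vs_{\chi}}(G)$ is the minimum size of a set $S\subseteq V(G)$ such that $\chi(G-S)=\chi(G)-1$; ${\rm ivs_{\chi}}(G)$ is the minimum size of an independent set $S\subseteq V(G)$ such that $\chi(G-S)=\chi(G)-1$. For $n\ge 9$, $S_n$ denotes the set of graphs $G$ on $n$ vertices with $\Delta(G)=4$, $\chi(G)=3$, ${\rm ivs_{\chi}}(G)=3$ and ${\rm vs_{\chi}}(G)=2$. *)

theory Defs
  imports "HOL-Analysis.Analysis" "Graph_Theory.Graph_Theory"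
begin

text \<open>
  Finite simple graphs are the symmetric loop-free digraphs of locale \<^locale>\<open>pair_graph\<close>: an
  undirected edge \<open>uv\<close> is the pair of arcs \<open>(u,v)\<close>, \<open>(v,u)\<close>. Accordingly, the degree of a
  vertex is its out-degree, and graph isomorphism is \<^const>\<open>digraph_iso\<close>.
\<close>

definition delete_verts :: "('a,'b) pre_digraph \<Rightarrow> 'a set \<Rightarrow> ('a,'b) pre_digraph" where
  "delete_verts G S = G \<restriction> (verts G - S)"

definition colorable :: "('a,'b) pre_digraph \<Rightarrow> nat \<Rightarrow> bool" where
  "colorable G k \<longleftrightarrow>
     (\<exists>c :: 'a \<Rightarrow> nat. (\<forall>v \<in> verts G. c v < k) \<and> (\<forall>u v. u \<rightarrow>\<^bsub>G\<^esub> v \<longrightarrow> c u \<noteq> c v))"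

definition chromatic_number :: "('a,'b) pre_digraph \<Rightarrow> nat" where
  "chromatic_number G = (LEAST k. colorable G k)"

definition max_degree :: "('a,'b) pre_digraph \<Rightarrow> nat" where
  "max_degree G = Max (out_degree G ` verts G)"

definition independent_verts :: "('a,'b) pre_digraph \<Rightarrow> 'a set \<Rightarrow> bool" where
  "independent_verts G S \<longleftrightarrow> S \<subseteq> verts G \<and> (\<forall>u \<in> S. \<forall>v \<in> S. \<not> u \<rightarrow>\<^bsub>G\<^esub> v)"

text \<open>
  Below, \<open>\<chi>(G - S) = \<chi>(G) - 1\<close> is written with the \<open>1\<close> on the left, avoiding truncated
  subtraction. For every graph with at least one vertex such an \<open>S\<close> exists (a colour class of an
  optimal colouring), so the minima are attained.
\<close>

definition vs_chi :: "('a,'b) pre_digraph \<Rightarrow> nat" where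
  "vs_chi G = (LEAST k. \<exists>S \<subseteq> verts G. card S = k \<and>
     chromatic_number (delete_verts G S) + 1 = chromatic_number G)"

definition ivs_chi :: "('a,'b) pre_digraph \<Rightarrow> nat" where
  "ivs_chi G = (LEAST k. \<exists>S. independent_verts G S \<and> card S = k \<and>
     chromatic_number (delete_verts G S) + 1 = chromatic_number G)"

definition S_graphs :: "nat \<Rightarrow> 'a pair_pre_digraph set" where
  "S_graphs n = {G. pair_graph G \<and> card (pverts G) = n \<and>
     max_degree (with_proj G) = 4 \<and> chromatic_number (with_proj G) = 3 \<and>
     ivs_chi (with_proj G) = 3 \<and> vs_chi (with_proj G) = 2}"

definition k_connected :: "nat \<Rightarrow> ('a,'b) pre_digraph \<Rightarrow> bool" where
  "k_connected k G \<longleftrightarrow> card (verts G) > k \<and>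
     (\<forall>X \<subseteq> verts G. card X < k \<longrightarrow> Digraph_Component.connected (delete_verts G X))"

definition undirected_edges :: "('a,'b) pre_digraph \<Rightarrow> 'a set set" where
  "undirected_edges G = {{u, v} | u v. u \<rightarrow>\<^bsub>G\<^esub> v}"

text \<open>
  A graph is planar if it can be drawn in the plane: vertices are distinct points, each edge is a
  simple arc between its endpoints passing through no other vertex, and two distinct edges meet at
  most in common endpoints.
\<close>

definition planar :: "('a,'b) pre_digraph \<Rightarrow> bool" where
  "planar G \<longleftrightarrow> (\<exists>(p :: 'a \<Rightarrow> complex) (\<gamma> :: 'a set \<Rightarrow> real \<Rightarrow> complex).
     inj_on p (verts G) \<and>
     (\<forall>e \<in> undirected_edges G.
        arc (\<gamma> e) \<and> {pathstart (\<gamma> e), pathfinish (\<gamma> e)} = p ` e \<and>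
        path_image (\<gamma> e) \<inter> p ` verts G = p ` e) \<and>
     (\<forall>e \<in> undirected_edges G. \<forall>f \<in> undirected_edges G.
        e \<noteq> f \<longrightarrow> path_image (\<gamma> e) \<inter> path_image (\<gamma> f) \<subseteq> p ` (e \<inter> f)))"

end

theory Submission
  imports Defs
begin

text \<open>
  Let \<open>a q b r c p\<close> be a hexagon and \<open>u v w\<close> a triangle with \<open>u\<close> joined to \<open>p, q\<close>, \<open>v\<close> to \<open>q, r\<close>
  and \<open>w\<close> to \<open>r, p\<close>. The triangles \<open>uvw, uvq, vwr, uwp\<close> and the pentagons \<open>vqapw, uqbrw, upcrv\<close> force
  every set meeting all odd cycles to contain two of \<open>u, v, w\<close> or to have at least three elements.
  This persists if a bipartite ladder is attached along \<open>a\<close> and \<open>b\<close>, and then \<open>{u, v}\<close> and the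
  independent set \<open>{v, p, b}\<close> still meet all odd cycles, so the stability numbers are 2 and 3.
  The two rails of the ladder start at \<open>a\<close> and \<open>b\<close>, and its rungs, each of which may be present or
  absent, join vertices whose distances from the triangles differ by one. Hence a rung does not
  change these distances, and the number of arcs inside each ball around the triangles reveals
  which rungs are present. Adding a common neighbour of \<open>b\<close> and \<open>c\<close> adjusts the parity of \<open>n\<close>.
  All these graphs have a Hamiltonian cycle whose chords split into two noncrossing families.
\<close>

lemma adj_delete_verts_with_proj:
  "a \<rightarrow>\<^bsub>delete_verts (with_proj G) S\<^esub> b \<longleftrightarrow>
     (a, b) \<in> parcs G \<and> a \<in> pverts G - S \<and> b \<in> pverts G - S"
  by (auto simp: delete_verts_def arcs_ends_conv image_iff)

subsection \<open>Chromatic vertex stability\<close>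

lemma colorable_delete_verts_iff:
  assumes "pair_wf_digraph G"
  shows "colorable (delete_verts (with_proj G) S) k \<longleftrightarrow>
     (\<exists>c. (\<forall>x \<in> pverts G - S. c x < k) \<and>
          (\<forall>x y. (x, y) \<in> parcs G \<longrightarrow> x \<notin> S \<longrightarrow> y \<notin> S \<longrightarrow> c x \<noteq> c y))"
proof -
  have "verts (delete_verts (with_proj G) S) = pverts G - S"
    by (simp add: delete_verts_def)
  moreover have "a \<in> pverts G \<and> b \<in> pverts G" if "(a, b) \<in> parcs G" for a b
    using that assms by (auto dest: pair_wf_digraph.wellformed')
  ultimately show ?thesis
    unfolding colorable_def adj_delete_verts_with_proj by (intro ex_cong1) auto
qed

lemma colorable_delete_verts_empty_iff:
  assumes "pair_wf_digraph G"
  shows "colorable (delete_verts (with_proj G) {}) k \<longleftrightarrow> colorable (with_proj G) k"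
  unfolding colorable_delete_verts_iff[OF assms] by (simp add: colorable_def)

lemma colorable_mono:
  assumes "colorable G k" "k \<le> l"
  shows "colorable G l"
proof -
  obtain c where "\<forall>x \<in> verts G. c x < k" "\<forall>x y. x \<rightarrow>\<^bsub>G\<^esub> y \<longrightarrow> c x \<noteq> c y"
    using assms(1) unfolding colorable_def by blast
  then show ?thesis
    using assms(2) unfolding colorable_def by (intro exI[of _ c]) auto
qed

text \<open>The existence of some colouring makes the \<open>LEAST\<close> in
  \<open>chromatic_number\<close> attained; monotonicity in the number of colours does the
  rest.\<close>

lemma chromatic_number_eq_Suc_iff:
  assumes "colorable G l"
  shows "chromatic_number G = Suc k \<longleftrightarrow> colorable G (Suc k) \<and> \<not> colorable G k"
proof -
  have "colorable G (chromatic_number G)"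
    unfolding chromatic_number_def using assms by (rule LeastI)
  moreover have "chromatic_number G \<le> j" if "colorable G j" for j
    unfolding chromatic_number_def using that by (rule Least_le)
  moreover have "colorable G k" if "chromatic_number G \<le> k"
    using calculation(1) that by (rule colorable_mono)
  ultimately show ?thesis
    by (metis Suc_n_not_le_n le_SucE)
qed

text \<open>All of \<open>T\<close> receives the fresh colour \<open>k\<close>. With
  \<open>T = S\<close> this bounds the chromatic number from above; with a singleton it shows that
  deleting one vertex less still leaves few colours.\<close>

lemma colorable_restore_independent:
  assumes "pair_wf_digraph G" "colorable (delete_verts (with_proj G) S) k"
    and "independent_verts (with_proj G) T"
  shows "colorable (delete_verts (with_proj G) (S - T)) (Suc k)"
proof -
  obtain c where c: "\<forall>x \<in> pverts G - S. c x < k"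
    "\<forall>x y. (x, y) \<in> parcs G \<longrightarrow> x \<notin> S \<longrightarrow> y \<notin> S \<longrightarrow> c x \<noteq> c y"
    using assms(1,2) by (auto simp: colorable_delete_verts_iff)
  have T: "(x, y) \<notin> parcs G" if "x \<in> T" "y \<in> T" for x y
    using assms(3) that by (auto simp: independent_verts_def)
  have v: "x \<in> pverts G \<and> y \<in> pverts G" if "(x, y) \<in> parcs G" for x y
    using that assms(1) by (auto dest: pair_wf_digraph.wellformed')
  define d where "d x = (if x \<in> T then k else c x)" for x
  have "\<forall>x \<in> pverts G - (S - T). d x < Suc k"
    using c(1) by (auto simp: d_def less_Suc_eq)
  moreover have "d x \<noteq> d y" if "(x, y) \<in> parcs G" "x \<notin> S - T" "y \<notin> S - T" for x y
  proof -
    have "c x < k" if "x \<notin> T" using c(1) v[OF \<open>(x, y) \<in> _\<close>] that \<open>x \<notin> S - T\<close> by auto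
    moreover have "c y < k" if "y \<notin> T" using c(1) v[OF \<open>(x, y) \<in> _\<close>] that \<open>y \<notin> S - T\<close> by auto
    ultimately show ?thesis using T c(2) that by (auto simp: d_def)
  qed
  ultimately show ?thesis
    unfolding colorable_delete_verts_iff[OF assms(1)] by blast
qed

lemma independent_verts_subset:
  "independent_verts G S \<Longrightarrow> T \<subseteq> S \<Longrightarrow> independent_verts G T"
  by (auto simp: independent_verts_def)

text \<open>Only 2-colourability has to be checked: if deleting \<open>A\<close> or \<open>B\<close>
  left a 1-colourable graph, putting one vertex back would leave a 2-colourable one, against the
  lower bounds.\<close>

lemma S_graphsI:
  assumes G: "pair_graph G" "card (pverts G) = n" "max_degree (with_proj G) = 4"
    and pair: "A \<subseteq> pverts G" "card A = 2" "colorable (delete_verts (with_proj G) A) 2"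
    and triple: "independent_verts (with_proj G) B" "card B = 3"
      "colorable (delete_verts (with_proj G) B) 2"
    and lower: "\<And>S. S \<subseteq> pverts G \<Longrightarrow> colorable (delete_verts (with_proj G) S) 2 \<Longrightarrow> card S \<ge> 2"
      "\<And>S. independent_verts (with_proj G) S \<Longrightarrow>
         colorable (delete_verts (with_proj G) S) 2 \<Longrightarrow> card S \<ge> 3"
  shows "G \<in> S_graphs n"
proof -
  interpret pair_graph G by fact
  have wf: "pair_wf_digraph G" ..
  have B: "B \<subseteq> pverts G" using triple(1) by (simp add: independent_verts_def)
  have fin: "finite A" "finite B" using pair(2) triple(2) by (auto intro: card_ge_0_finite)
  have single: "independent_verts (with_proj G) {x}" if "x \<in> pverts G" for x
    using that pair_no_loops by (fastforce simp: independent_verts_def)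
  \<comment> \<open>Restoring all of \<open>B\<close> with a third colour bounds the chromatic
    number by 3.\<close>
  have "colorable (delete_verts (with_proj G) (B - B)) (Suc 2)"
    using colorable_restore_independent[OF wf triple(3) triple(1)] .
  then have col3: "colorable (with_proj G) 3"
    using colorable_delete_verts_empty_iff[OF wf] by simp
  have "\<not> colorable (with_proj G) 2"
    using lower(1)[of "{}"] colorable_delete_verts_empty_iff[OF wf] by auto
  then have chi: "chromatic_number (with_proj G) = 3"
    using chromatic_number_eq_Suc_iff[OF col3, of 2] col3 by simp
  have sub3: "colorable (delete_verts (with_proj G) S) 3" for S
    using col3 unfolding colorable_delete_verts_iff[OF wf] by (auto simp: colorable_def)
  have chiS: "chromatic_number (delete_verts (with_proj G) S) + 1 = chromatic_number (with_proj G) \<longleftrightarrow>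
      colorable (delete_verts (with_proj G) S) 2 \<and> \<not> colorable (delete_verts (with_proj G) S) 1" for S
    using chromatic_number_eq_Suc_iff[OF sub3, of S 1] unfolding chi by (simp add: numeral_2_eq_2)
  have restore: "colorable (delete_verts (with_proj G) (S - {x})) 2"
    if "colorable (delete_verts (with_proj G) S) 1" "x \<in> pverts G" for S x
    using colorable_restore_independent[OF wf that(1) single[OF that(2)]] by (simp add: numeral_2_eq_2)
  have A1: "\<not> colorable (delete_verts (with_proj G) A) 1"
  proof
    assume *: "colorable (delete_verts (with_proj G) A) 1"
    obtain x where "x \<in> A" using pair(2) by (auto simp: card_2_iff)
    then have "card (A - {x}) \<ge> 2" using lower(1)[of "A - {x}"] restore[OF *, of x] pair(1) by auto
    then show False using \<open>x \<in> A\<close> fin pair(2) by simp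
  qed
  have B1: "\<not> colorable (delete_verts (with_proj G) B) 1"
  proof
    assume *: "colorable (delete_verts (with_proj G) B) 1"
    obtain x where "x \<in> B" using triple(2) by (auto simp: card_3_iff)
    then have "card (B - {x}) \<ge> 3"
      using lower(2)[of "B - {x}"] restore[OF *, of x] B independent_verts_subset[OF triple(1)]
      by auto
    then show False using \<open>x \<in> B\<close> fin triple(2) by simp
  qed
  have "vs_chi (with_proj G) = 2"
    unfolding vs_chi_def chiS using pair lower(1) A1 by (intro Least_equality) auto
  moreover have "ivs_chi (with_proj G) = 3"
    unfolding ivs_chi_def chiS using triple lower(2) B1 by (intro Least_equality) auto
  ultimately show ?thesis
    using G chi by (simp add: S_graphs_def)
qed

subsection \<open>Hamiltonian graphs are 2-connected\<close>

text \<open>At most one vertex is deleted. If it does not lie between \<open>i\<close> and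
  \<open>j\<close>, the segment of the path from \<open>i\<close> to \<open>j\<close> survives;
  otherwise the route through 0 and \<open>n - 1\<close> does.\<close>

lemma hamiltonian_imp_2_connected:
  assumes "pair_graph G" "pverts G = {..<n}" "n \<ge> 3"
    and path: "\<And>i. Suc i < n \<Longrightarrow> (i, Suc i) \<in> parcs G" and closing: "(0, n - 1) \<in> parcs G"
  shows "k_connected 2 (with_proj G)"
proof -
  interpret pair_graph G by fact
  have "Digraph_Component.connected (delete_verts (with_proj G) X)" if X: "card X < 2" "X \<subseteq> {..<n}" for X
  proof -
    have "finite X" using X(2) finite_subset by blast
    with X obtain x where x: "X \<subseteq> {x}"
      using less_2_cases[OF X(1)] by (auto simp: card_Suc_eq)
    let ?H = "delete_verts (with_proj G) X"
    interpret H: wf_digraph ?H unfolding delete_verts_def by (rule wellformed_induce_subgraph)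
    have adj: "a \<rightarrow>\<^bsub>?H\<^esub> b \<longleftrightarrow> (a, b) \<in> parcs G \<and> a \<notin> X \<and> b \<notin> X" for a b
      unfolding adj_delete_verts_with_proj using wellformed' by auto
    have symG: "(b, a) \<in> parcs G" if "(a, b) \<in> parcs G" for a b
      using that sym_arcs by (auto simp: symmetric_def sym_def)
    have symH: "symmetric ?H"
      unfolding symmetric_def sym_def using symG by (simp add: adj)
    have up: "i \<rightarrow>\<^sup>*\<^bsub>?H\<^esub> j" if "i \<le> j" "j < n" "{i..j} \<inter> X = {}" for i j
      using that
    proof (induction rule: dec_induct)
      case base
      then have "i \<in> verts ?H" by (auto simp: delete_verts_def assms(2))
      then show ?case by simp
    next
      case (step k)
      then have "{i..k} \<inter> X = {}" by force
      then have "i \<rightarrow>\<^sup>*\<^bsub>?H\<^esub> k" using step by simp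
      moreover have "k \<in> {i..Suc k}" "Suc k \<in> {i..Suc k}" using step by auto
      then have "k \<rightarrow>\<^bsub>?H\<^esub> Suc k" using step path[of k] unfolding adj by blast
      ultimately show ?case by (rule H.reachable_adj_trans)
    qed
    note reach_sym = symmetric_reachable[OF symH]
    have "i \<rightarrow>\<^sup>*\<^bsub>?H\<^esub> j" if ij: "i \<le> j" "j < n" "i \<notin> X" "j \<notin> X" for i j
    proof (cases "{i..j} \<inter> X = {}")
      case True
      then show ?thesis using up ij by simp
    next
      case False
      then have X: "X = {x}" "i < x" "x < j" using x ij by (auto simp: less_le)
      have "0 \<rightarrow>\<^sup>*\<^bsub>?H\<^esub> i" using X ij by (intro up) auto
      then have "i \<rightarrow>\<^sup>*\<^bsub>?H\<^esub> 0" by (rule reach_sym)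
      also have "0 \<rightarrow>\<^bsub>?H\<^esub> (n - 1)" unfolding adj using closing X ij by auto
      also have "j \<rightarrow>\<^sup>*\<^bsub>?H\<^esub> (n - 1)" using X ij by (intro up) auto
      then have "(n - 1) \<rightarrow>\<^sup>*\<^bsub>?H\<^esub> j" by (rule reach_sym)
      finally show ?thesis .
    qed
    then have "i \<rightarrow>\<^sup>*\<^bsub>?H\<^esub> j" if "i < n" "j < n" "i \<notin> X" "j \<notin> X" for i j
      using that reach_sym by (cases i j rule: le_cases) auto
    moreover have "verts ?H = {..<n} - X" by (simp add: delete_verts_def assms(2))
    \<comment> \<open>Connectedness includes having at least one vertex.\<close>
    moreover have "{..<n} - X \<noteq> {}"
    proof -
      have "0 \<in> {..<n} - {x} \<or> 1 \<in> {..<n} - {x}" using \<open>n \<ge> 3\<close> by auto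
      then show ?thesis using x by auto
    qed
    ultimately show ?thesis
      by (intro H.connectedI) (auto simp: H.reachable_mk_symmetric_eq[OF symH])
  qed
  then show ?thesis using assms(2,3) by (simp add: k_connected_def)
qed

subsection \<open>Two-page book embeddings\<close>

text \<open>The parabola \<open>y = h (x - a) (b - x)\<close> with \<open>x = a + t (b - a)\<close>:
  the two factors in \<open>t\<close> are \<open>x - a\<close> and \<open>b - x\<close>. The sign of
  \<open>h\<close> selects the page.\<close>

definition book_arc :: "real \<Rightarrow> real \<Rightarrow> real \<Rightarrow> real \<Rightarrow> complex" where
  "book_arc h a b t = Complex (a + t * (b - a)) (h * ((t * (b - a)) * ((1 - t) * (b - a))))"

lemma path_image_book_arc:
  assumes "a < b"
  shows "path_image (book_arc h a b) = {z. a \<le> Re z \<and> Re z \<le> b \<and> Im z = h * ((Re z - a) * (b - Re z))}"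
proof (intro set_eqI iffI)
  fix z assume "z \<in> path_image (book_arc h a b)"
  then obtain t where t: "0 \<le> t" "t \<le> 1" "z = book_arc h a b t" by (auto simp: path_image_def)
  have "t * (b - a) \<le> b - a" using t assms by (simp add: mult_left_le_one_le)
  then have "a + t * (b - a) \<le> b" by linarith
  moreover have "b - Re z = (1 - t) * (b - a)" using t by (simp add: book_arc_def algebra_simps)
  ultimately show "z \<in> {z. a \<le> Re z \<and> Re z \<le> b \<and> Im z = h * ((Re z - a) * (b - Re z))}"
    using t(1,2) assms unfolding t(3) by (simp add: book_arc_def)
next
  fix z assume z: "z \<in> {z. a \<le> Re z \<and> Re z \<le> b \<and> Im z = h * ((Re z - a) * (b - Re z))}"
  define t where "t = (Re z - a) / (b - a)"
  have t: "t * (b - a) = Re z - a" using assms by (simp add: t_def)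
  then have "(1 - t) * (b - a) = b - Re z" by (simp add: algebra_simps)
  then have "z = book_arc h a b t" using z t by (simp add: book_arc_def complex_eq_iff)
  moreover have "t \<in> {0..1}" using z assms by (auto simp: t_def field_simps)
  ultimately show "z \<in> path_image (book_arc h a b)" by (auto simp: path_image_def)
qed

lemma arc_book_arc: "a < b \<Longrightarrow> arc (book_arc h a b)"
  unfolding arc_def path_def
  by (auto intro!: inj_onI continuous_intros simp: book_arc_def Complex_eq complex_eq_iff)

text \<open>Enlarging the interval first at \<open>b\<close> and then at \<open>a\<close> cannot
  decrease the product, so equal values force equality in both steps and two products vanish. For
  distinct intervals only a common endpoint remains.\<close>

lemma nested_parabolas_meet:
  fixes x :: real
  assumes "a' \<le> a" "b \<le> b'" "a \<le> x" "x \<le> b" "(a, b) \<noteq> (a', b')"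
    and "(x - a) * (b - x) = (x - a') * (b' - x)"
  shows "x = a \<and> x = a' \<or> x = b \<and> x = b'"
proof -
  have "(x - a) * (b - x) \<le> (x - a) * (b' - x)" "(x - a) * (b' - x) \<le> (x - a') * (b' - x)"
    using assms(1-4) by (auto intro: mult_left_mono mult_right_mono)
  then have "(x - a) * (b' - b) = 0" "(a - a') * (b' - x) = 0"
    using assms(6) by (auto simp: algebra_simps)
  then show ?thesis using assms by auto
qed

definition noncrossing :: "('a :: linorder \<times> 'a) set \<Rightarrow> bool" where
  "noncrossing E \<longleftrightarrow> (\<forall>(a, b) \<in> E. \<forall>(c, d) \<in> E. \<not> (a < c \<and> c < b \<and> b < d))"

text \<open>Intervals that do not interleave are nested or share at most one point, so parabolas on
  one page meet only at a common endpoint.\<close>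

lemma noncrossing_parabolas_meet:
  fixes x :: real and a b c d :: nat
  assumes "noncrossing E" "(a, b) \<in> E" "(c, d) \<in> E" "(a, b) \<noteq> (c, d)"
    and x: "real a \<le> x" "x \<le> real b" "real c \<le> x" "x \<le> real d"
    and eq: "(x - real a) * (real b - x) = (x - real c) * (real d - x)"
  shows "x \<in> real ` ({a, b} \<inter> {c, d})"
proof -
  have "\<not> (a < c \<and> c < b \<and> b < d)" "\<not> (c < a \<and> a < d \<and> d < b)"
    using assms(1-3) unfolding noncrossing_def by fast+
  then consider "b \<le> c" | "d \<le> a" | "a \<le> c" "d \<le> b" | "c \<le> a" "b \<le> d" by linarith
  then show ?thesis
  proof cases
    case 1
    then have "x = real b \<and> x = real c" using x by linarith
    then show ?thesis by auto
  next
    case 2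
    then have "x = real a \<and> x = real d" using x by linarith
    then show ?thesis by auto
  next
    case 3
    then have "x = real c \<and> x = real a \<or> x = real d \<and> x = real b"
      using x eq assms(4) by (intro nested_parabolas_meet) auto
    then show ?thesis by auto
  next
    case 4
    then have "x = real a \<and> x = real c \<or> x = real b \<and> x = real d"
      using x eq assms(4) by (intro nested_parabolas_meet) auto
    then show ?thesis by auto
  qed
qed

text \<open>
  The vertices lie on the real axis and an edge \<open>{a, b}\<close> is drawn as the parabola
  \<open>y = (x - a) (b - x)\<close> or its mirror image; equal leading coefficients make nested parabolas disjoint
  except at common endpoints.
\<close>

lemma two_page_book_imp_planar:
  fixes G :: "(nat, 'b) pre_digraph"
  assumes "wf_digraph G"
    and edges: "\<And>i j. i \<rightarrow>\<^bsub>G\<^esub> j \<Longrightarrow> i \<noteq> j \<and> (min i j, max i j) \<in> U \<union> D"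
    and "noncrossing U" "noncrossing D"
  shows "planar G"
proof -
  have in_verts: "i \<in> verts G \<and> j \<in> verts G" if "i \<rightarrow>\<^bsub>G\<^esub> j" for i j
    using that wf_digraph.adj_in_verts[OF assms(1)] by blast
  \<comment> \<open>\<open>Min\<close> and \<open>Max\<close> recover the ordered pair from the edge
    as a set; an edge listed in both \<open>U\<close> and \<open>D\<close> is drawn above.\<close>
  define h :: "nat set \<Rightarrow> real" where "h e = (if (Min e, Max e) \<in> U then 1 else -1)" for e
  define \<gamma> where "\<gamma> e = book_arc (h e) (real (Min e)) (real (Max e))" for e
  have h0: "h e \<noteq> 0" for e by (simp add: h_def)
  have E: "e = {Min e, Max e} \<and> Min e < Max e \<and> (Min e, Max e) \<in> U \<union> D \<and> e \<subseteq> verts G"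
    if e: "e \<in> undirected_edges G" for e
  proof -
    obtain i j where ij: "e = {i, j}" "i \<rightarrow>\<^bsub>G\<^esub> j" using e by (auto simp: undirected_edges_def)
    then have "Min e = min i j" "Max e = max i j" by auto
    then show ?thesis using ij edges[OF ij(2)] in_verts[OF ij(2)] by (auto simp: min_def max_def)
  qed
  have img: "z \<in> path_image (\<gamma> e) \<longleftrightarrow> real (Min e) \<le> Re z \<and> Re z \<le> real (Max e) \<and>
      Im z = h e * ((Re z - real (Min e)) * (real (Max e) - Re z))"
    if "e \<in> undirected_edges G" for z e
    using path_image_book_arc[of "Min e" "Max e"] E[OF that] by (simp add: \<gamma>_def)
  have on_spine: "z \<in> of_nat ` e" if "e \<in> undirected_edges G" "z \<in> path_image (\<gamma> e)" "Im z = 0" for e z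
  proof -
    have "z = of_nat (Min e) \<or> z = of_nat (Max e)"
      using that h0[of e] by (auto simp: img complex_eq_iff)
    then show ?thesis using E[OF that(1)] by (metis imageI insertCI)
  qed
  have ends: "of_nat k \<in> path_image (\<gamma> e)" if "e \<in> undirected_edges G" "k \<in> e" for e k
  proof -
    have "k = Min e \<or> k = Max e" using E[OF that(1)] that(2) by blast
    then show ?thesis using E[OF that(1)] that(1) by (auto simp: img)
  qed
  have "inj_on (of_nat :: nat \<Rightarrow> complex) (verts G)" by (auto intro: inj_onI)
  moreover have "arc (\<gamma> e) \<and> {pathstart (\<gamma> e), pathfinish (\<gamma> e)} = of_nat ` e \<and>
      path_image (\<gamma> e) \<inter> of_nat ` verts G = of_nat ` e" if e: "e \<in> undirected_edges G" for e
  proof (intro conjI)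
    show "arc (\<gamma> e)" using E[OF e] by (simp add: \<gamma>_def arc_book_arc)
    have "pathstart (\<gamma> e) = of_nat (Min e)" "pathfinish (\<gamma> e) = of_nat (Max e)"
      by (auto simp: \<gamma>_def book_arc_def pathstart_def pathfinish_def complex_eq_iff)
    then show "{pathstart (\<gamma> e), pathfinish (\<gamma> e)} = of_nat ` e"
      using E[OF e] by (metis image_empty image_insert)
    show "path_image (\<gamma> e) \<inter> of_nat ` verts G = of_nat ` e"
      using on_spine[OF e] ends[OF e] E[OF e] by fastforce
  qed
  moreover have "path_image (\<gamma> e) \<inter> path_image (\<gamma> f) \<subseteq> of_nat ` (e \<inter> f)"
    if e: "e \<in> undirected_edges G" and f: "f \<in> undirected_edges G" and "e \<noteq> f" for e f
  proof
    fix z assume z: "z \<in> path_image (\<gamma> e) \<inter> path_image (\<gamma> f)"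
    show "z \<in> of_nat ` (e \<inter> f)"
    proof (cases "Im z = 0")
      case True
      then have "z \<in> of_nat ` e" "z \<in> of_nat ` f" using on_spine e f z by auto
      then show ?thesis by auto
    next
      case False
      have *: "real (Min e) \<le> Re z" "Re z \<le> real (Max e)" "real (Min f) \<le> Re z" "Re z \<le> real (Max f)"
        "Im z = h e * ((Re z - real (Min e)) * (real (Max e) - Re z))"
        "Im z = h f * ((Re z - real (Min f)) * (real (Max f) - Re z))"
        using z e f by (auto simp: img)
      have nonneg: "(Re z - real (Min e)) * (real (Max e) - Re z) \<ge> 0"
        "(Re z - real (Min f)) * (real (Max f) - Re z) \<ge> 0" using * by auto
      \<comment> \<open>Curves on different pages lie on opposite sides of the real axis, and
        \<open>z\<close> is off the axis.\<close>
      have "h e = h f"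
      proof (rule ccontr)
        assume "h e \<noteq> h f"
        then have "h e = - h f" "h f = 1 \<or> h f = -1" by (auto simp: h_def split: if_splits)
        then have "Im z \<ge> 0 \<and> Im z \<le> 0" using *(5,6) nonneg by auto
        then show False using False by auto
      qed
      \<comment> \<open>Edges with equal sign come from one noncrossing set: above both lie in
        \<open>U\<close>, below both lie in \<open>D\<close>.\<close>
      moreover from this have "(Min e, Max e) \<in> U \<and> (Min f, Max f) \<in> U \<or>
          (Min e, Max e) \<in> D \<and> (Min f, Max f) \<in> D"
        using E[OF e] E[OF f] by (auto simp: h_def split: if_splits)
      moreover have "(Min e, Max e) \<noteq> (Min f, Max f)" using E[OF e] E[OF f] \<open>e \<noteq> f\<close> by (metis Pair_inject)
      moreover have "(Re z - real (Min e)) * (real (Max e) - Re z) = (Re z - real (Min f)) * (real (Max f) - Re z)"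
        using *(5,6) \<open>h e = h f\<close> h0 by (metis mult_left_cancel)
      ultimately have "Re z \<in> real ` ({Min e, Max e} \<inter> {Min f, Max f})"
        using *(1-4) noncrossing_parabolas_meet assms(3,4) by blast
      then have "Im z = 0" using *(5) by auto
      with False show ?thesis ..
    qed
  qed
  ultimately show ?thesis unfolding planar_def by blast
qed

subsection \<open>An isomorphism invariant\<close>

definition triangle_verts :: "'a pair_pre_digraph \<Rightarrow> 'a set" where
  "triangle_verts G = {x. \<exists>y z. (x, y) \<in> parcs G \<and> (y, z) \<in> parcs G \<and> (z, x) \<in> parcs G}"

definition grow :: "'a pair_pre_digraph \<Rightarrow> 'a set \<Rightarrow> 'a set" where
  "grow G X = X \<union> parcs G `` X"

definition triangle_ball :: "nat \<Rightarrow> 'a pair_pre_digraph \<Rightarrow> 'a set" where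
  "triangle_ball k G = (grow G ^^ k) (triangle_verts G)"

text \<open>In general an isomorphism carries a separate map on arcs. Here tails and heads are
  \<open>fst\<close> and \<open>snd\<close> on both sides, so the vertex map determines the arc
  map.\<close>

lemma digraph_iso_with_projE:
  assumes "digraph_iso (with_proj G) (with_proj H)"
  obtains \<phi> where "pair_wf_digraph G" "inj_on \<phi> (pverts G)" "parcs H = map_prod \<phi> \<phi> ` parcs G"
proof -
  from assms obtain \<psi> where iso: "pre_digraph.digraph_isomorphism (with_proj G) \<psi>"
    and H: "with_proj H = app_iso \<psi> (with_proj G)"
    unfolding digraph_iso_def by blast
  have "iso_tail \<psi> = fst" "iso_head \<psi> = snd" "parcs H = iso_arcs \<psi> ` parcs G"
    using arg_cong[OF H, of tail] arg_cong[OF H, of head] arg_cong[OF H, of arcs] by simp_all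
  moreover from this have "iso_arcs \<psi> e = map_prod (iso_verts \<psi>) (iso_verts \<psi>) e" if "e \<in> parcs G" for e
    using iso that by (auto simp: pre_digraph.digraph_isomorphism_def map_prod_def split_beta prod_eq_iff)
  ultimately have "parcs H = map_prod (iso_verts \<psi>) (iso_verts \<psi>) ` parcs G" by simp
  moreover have "pair_wf_digraph G" "inj_on (iso_verts \<psi>) (pverts G)"
    using iso by (auto simp: pre_digraph.digraph_isomorphism_def wf_digraph_wp_iff)
  ultimately show thesis using that by blast
qed

text \<open>An isomorphism carries triangles to triangles and neighbourhoods to neighbourhoods,
  hence balls to balls of the same radius.\<close>

lemma digraph_iso_card_triangle_ball:
  assumes "digraph_iso (with_proj G) (with_proj H)"
  shows "card (parcs G \<inter> triangle_ball k G \<times> triangle_ball k G) =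
         card (parcs H \<inter> triangle_ball k H \<times> triangle_ball k H)"
proof -
  obtain \<phi> where G: "pair_wf_digraph G" and inj: "inj_on \<phi> (pverts G)"
    and H: "parcs H = map_prod \<phi> \<phi> ` parcs G"
    using digraph_iso_with_projE[OF assms] .
  have V: "x \<in> pverts G" "y \<in> pverts G" if "(x, y) \<in> parcs G" for x y
    using G that by (auto dest: pair_wf_digraph.wellformed')
  have H_iff: "(\<phi> x, \<phi> y) \<in> parcs H \<longleftrightarrow> (x, y) \<in> parcs G" if "x \<in> pverts G" "y \<in> pverts G" for x y
  proof
    assume "(\<phi> x, \<phi> y) \<in> parcs H"
    then obtain x' y' where xy: "(x', y') \<in> parcs G" "\<phi> x = \<phi> x'" "\<phi> y = \<phi> y'"
      unfolding H by auto
    then have "x = x'" "y = y'" using V that inj_onD[OF inj] by blast+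
    with xy show "(x, y) \<in> parcs G" by simp
  qed (auto simp: H)
  have H_E: "\<exists>x y. a = \<phi> x \<and> b = \<phi> y \<and> (x, y) \<in> parcs G" if "(a, b) \<in> parcs H" for a b
    using that unfolding H by auto
  have "triangle_verts H = \<phi> ` triangle_verts G"
  proof (intro equalityI subsetI)
    fix a assume "a \<in> triangle_verts H"
    then obtain b c where abc: "(a, b) \<in> parcs H" "(b, c) \<in> parcs H" "(c, a) \<in> parcs H"
      by (auto simp: triangle_verts_def)
    then obtain x y z where "a = \<phi> x" "b = \<phi> y" "c = \<phi> z"
      "x \<in> pverts G" "y \<in> pverts G" "z \<in> pverts G"
      using H_E V by metis
    with abc show "a \<in> \<phi> ` triangle_verts G"
      unfolding triangle_verts_def by (auto simp: H_iff)
  next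
    fix a assume "a \<in> \<phi> ` triangle_verts G"
    then show "a \<in> triangle_verts H"
      using V H_iff unfolding triangle_verts_def by blast
  qed
  moreover have "triangle_verts G \<subseteq> pverts G"
    using V by (auto simp: triangle_verts_def)
  \<comment> \<open>The inclusion in the vertex set accompanies the induction because
    \<open>\<phi>\<close> is injective only there.\<close>
  moreover have grow: "grow H (\<phi> ` X) = \<phi> ` grow G X \<and> grow G X \<subseteq> pverts G"
    if X: "X \<subseteq> pverts G" for X
  proof -
    have "parcs H `` (\<phi> ` X) = \<phi> ` (parcs G `` X)"
    proof (intro equalityI subsetI)
      fix b assume "b \<in> parcs H `` (\<phi> ` X)"
      then obtain x where x: "x \<in> X" "(\<phi> x, b) \<in> parcs H" by auto
      then obtain y where "b = \<phi> y" "y \<in> pverts G" using H_E V by metis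
      with x X show "b \<in> \<phi> ` (parcs G `` X)" using H_iff by blast
    next
      fix b assume "b \<in> \<phi> ` (parcs G `` X)"
      then show "b \<in> parcs H `` (\<phi> ` X)" using V H_iff by blast
    qed
    then show ?thesis using X V by (auto simp: grow_def)
  qed
  ultimately have ball: "triangle_ball k H = \<phi> ` triangle_ball k G \<and> triangle_ball k G \<subseteq> pverts G"
    unfolding triangle_ball_def by (induction k) auto
  let ?B = "triangle_ball k G"
  have "parcs H \<inter> (\<phi> ` ?B) \<times> (\<phi> ` ?B) = map_prod \<phi> \<phi> ` (parcs G \<inter> ?B \<times> ?B)"
  proof (intro equalityI subsetI)
    fix e assume "e \<in> parcs H \<inter> (\<phi> ` ?B) \<times> (\<phi> ` ?B)"
    then obtain x y where "e = (\<phi> x, \<phi> y)" "x \<in> ?B" "y \<in> ?B" "(\<phi> x, \<phi> y) \<in> parcs H" by auto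
    moreover from this have "(x, y) \<in> parcs G" using H_iff ball by blast
    ultimately show "e \<in> map_prod \<phi> \<phi> ` (parcs G \<inter> ?B \<times> ?B)" by force
  qed (auto simp: H)
  moreover have "inj_on (map_prod \<phi> \<phi>) (parcs G \<inter> ?B \<times> ?B)"
    using ball by (intro inj_on_subset[OF map_prod_inj_on[OF inj inj]]) auto
  ultimately show ?thesis
    using ball by (simp add: card_image)
qed

subsection \<open>Attaching a ladder to a core\<close>

definition edge_adj :: "('a \<times> 'a) set \<Rightarrow> 'a \<Rightarrow> 'a \<Rightarrow> bool" where
  "edge_adj E i j \<longleftrightarrow> (i, j) \<in> E \<or> (j, i) \<in> E"

text \<open>Level 0 of the rails is \<open>m\<close> and 0. Rung \<open>i\<close> joins level
  \<open>i\<close> of the first rail to level \<open>i + 1\<close> of the second. Its ends sum to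
  \<open>2 * m + 2 * s + 1\<close>: the odd sum respects the alternating colouring, the constant sum
  makes rungs nested in the drawing. For \<open>i = s\<close> the pair would be an edge of the path,
  hence \<open>R \<subseteq> {..<s}\<close> below.\<close>

definition ladder_edges :: "nat \<Rightarrow> nat \<Rightarrow> nat set \<Rightarrow> (nat \<times> nat) set" where
  "ladder_edges m s R = {(i, Suc i) |i. m \<le> i \<and> i < m + 2 * s + 1} \<union> {(0, m + 2 * s + 1)} \<union>
     {(m + i, m + 2 * s + 1 - i) |i. i \<in> R}"

text \<open>
  The core has the vertices \<open>0, \<dots>, m\<close> in the order of a Hamiltonian path; \<open>m\<close> and \<open>0\<close> are the
  hexagon vertices \<open>a\<close> and \<open>b\<close>. The chords \<open>U\<close> and \<open>D\<close> go to the upper and lower page of the book,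
  \<open>f\<close> and \<open>g\<close> are 2-colourings of the core without \<open>{u, v}\<close> and without \<open>{v, p, b}\<close>. The ladder
  continues the path by \<open>m + 1, \<dots>, m + 2 s + 1\<close> and closes it to a cycle; the \<open>k\<close>-th vertices of its
  rails are \<open>m + k\<close> and \<open>m + 2 s + 2 - k\<close>.
\<close>

locale hamiltonian_core =
  fixes m :: nat and U D :: "(nat \<times> nat) set"
begin

definition adj :: "nat \<Rightarrow> nat \<Rightarrow> bool" where
  "adj = edge_adj (U \<union> D \<union> {(i, Suc i) |i. i < m})"

end

locale stability_core = hamiltonian_core +
  fixes u v w p q r c :: nat and f g :: "nat \<Rightarrow> nat"
  assumes chords: "\<And>i j. (i, j) \<in> U \<union> D \<Longrightarrow> i < j \<and> j \<le> m"
    and noncrossing: "noncrossing U" "noncrossing D"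
    and distinct: "distinct [u, v, w, p, q, r, c]"
    and inner: "{u, v, w, p, q, r, c} \<subseteq> {0<..<m}"
    and triangle: "adj u v" "adj v w" "adj u w"
    and spokes: "adj u p" "adj u q" "adj v q" "adj v r" "adj w r" "adj w p"
    and hexagon: "adj p m" "adj q m" "adj q 0" "adj r 0" "adj r c" "adj p c"
    and nbs: "\<And>i. adj u i \<Longrightarrow> i \<in> {v, w, p, q}" "\<And>i. adj v i \<Longrightarrow> i \<in> {u, w, q, r}"
    and not_adj: "\<not> adj p 0"
    and near: "\<And>i. i \<le> m \<Longrightarrow> i \<in> {u, v, w, p, q, r, c, 0, m} \<or> adj c i"
    and degree: "\<And>i. card {j. adj i j} \<le> 4" "card {j. adj 0 j} \<le> 3" "card {j. adj m j} \<le> 2"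
    and f: "\<And>i. f i < 2" "f 0 = f m"
      "\<And>i j. adj i j \<Longrightarrow> i \<notin> {u, v} \<Longrightarrow> j \<notin> {u, v} \<Longrightarrow> f i \<noteq> f j"
    and g: "\<And>i. g i < 2"
      "\<And>i j. adj i j \<Longrightarrow> i \<notin> {v, p, 0} \<Longrightarrow> j \<notin> {v, p, 0} \<Longrightarrow> g i \<noteq> g j"
begin

definition ladder :: "nat \<Rightarrow> nat set \<Rightarrow> nat pair_pre_digraph" where
  "ladder s R = \<lparr>pverts = {..<m + 2 * s + 2},
     parcs = {(i, j). adj i j \<or> edge_adj (ladder_edges m s R) i j}\<rparr>"

lemma pverts_ladder [simp]: "pverts (ladder s R) = {..<m + 2 * s + 2}"
  by (simp add: ladder_def)

lemma parcs_ladder [simp]: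
  "(i, j) \<in> parcs (ladder s R) \<longleftrightarrow> adj i j \<or> edge_adj (ladder_edges m s R) i j"
  by (simp add: ladder_def)

lemma adj_sym: "adj i j \<longleftrightarrow> adj j i"
  by (auto simp: adj_def edge_adj_def)

lemma adj_le: "adj i j \<Longrightarrow> i \<noteq> j \<and> i \<le> m \<and> j \<le> m"
  unfolding adj_def edge_adj_def using chords by fastforce

context
  fixes s :: nat and R :: "nat set"
  assumes R: "R \<subseteq> {..<s}"
begin

lemma rung_less: "k \<in> R \<Longrightarrow> k < s"
  using R by auto

lemma ladder_adjE:
  assumes "edge_adj (ladder_edges m s R) i j"
  obtains "m \<le> i" "j = Suc i" "i \<le> m + 2 * s" | "m \<le> j" "i = Suc j" "j \<le> m + 2 * s"
    | "i = 0" "j = m + 2 * s + 1" | "j = 0" "i = m + 2 * s + 1"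
    | k where "k \<in> R" "k < s" "i = m + k" "j = m + 2 * s + 1 - k"
    | k where "k \<in> R" "k < s" "j = m + k" "i = m + 2 * s + 1 - k"
  using assms rung_less unfolding edge_adj_def ladder_edges_def by fastforce

lemma m_pos: "m > 0"
  using inner by auto

lemma pair_graph_ladder: "pair_graph (ladder s R)"
proof -
  have "i < m + 2 * s + 2 \<and> j < m + 2 * s + 2 \<and> i \<noteq> j" if "adj i j" for i j
    using adj_le[OF that] by auto
  moreover have "i < m + 2 * s + 2 \<and> j < m + 2 * s + 2 \<and> i \<noteq> j"
    if "edge_adj (ladder_edges m s R) i j" for i j
    using that by (elim ladder_adjE) auto
  ultimately have V: "i < m + 2 * s + 2 \<and> j < m + 2 * s + 2 \<and> i \<noteq> j"
    if "(i, j) \<in> parcs (ladder s R)" for i j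
    using that by auto
  have "parcs (ladder s R) \<subseteq> {..<m + 2 * s + 2} \<times> {..<m + 2 * s + 2}"
    using V by auto
  then have "finite (parcs (ladder s R))"
    by (rule finite_subset) simp
  moreover have "symmetric (with_proj (ladder s R))"
    unfolding symmetric_def sym_def using adj_sym by (auto simp: edge_adj_def)
  ultimately show ?thesis
    using V by unfold_locales auto
qed

lemma parcs_ladder_inner:
  assumes "0 < i" "i < m"
  shows "(i, j) \<in> parcs (ladder s R) \<longleftrightarrow> adj i j" "(j, i) \<in> parcs (ladder s R) \<longleftrightarrow> adj i j"
proof -
  have "\<not> edge_adj (ladder_edges m s R) i j"
    using assms by (auto elim: ladder_adjE)
  then show "(i, j) \<in> parcs (ladder s R) \<longleftrightarrow> adj i j" "(j, i) \<in> parcs (ladder s R) \<longleftrightarrow> adj i j"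
    using adj_sym by (auto simp: edge_adj_def)
qed

text \<open>The degree bounds of the core leave room for the ladder: 0 gains only
  \<open>m + 2 * s + 1\<close>, \<open>m\<close> gains at most its successor and the other end of
  rung 0, and ladder vertices have degree at most 3. The value 4 is attained at
  \<open>u\<close>.\<close>

lemma max_degree_ladder: "max_degree (with_proj (ladder s R)) = 4"
proof -
  let ?nb = "\<lambda>i. {j. (i, j) \<in> parcs (ladder s R)}"
  have deg: "out_degree (with_proj (ladder s R)) i = card (?nb i)" for i
  proof -
    have "out_arcs (with_proj (ladder s R)) i = Pair i ` ?nb i" by auto
    then show ?thesis unfolding out_degree_def by (simp add: card_image inj_on_def)
  qed
  have fin: "finite {j. adj i j}" for i
    using adj_le by (auto intro: finite_subset[of _ "{..m}"])
  have "card (?nb i) \<le> 4" for i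
  proof -
    consider "i = 0" | "i = m" | "0 < i" "i < m" | "m < i" by force
    then show ?thesis
    proof cases
      case 1
      have "?nb i \<subseteq> insert (m + 2 * s + 1) {j. adj 0 j}"
        using 1 m_pos by (auto elim!: ladder_adjE)
      then have "card (?nb i) \<le> card (insert (m + 2 * s + 1) {j. adj 0 j})"
        using fin by (intro card_mono) auto
      also have "\<dots> \<le> 4" using card_insert_le_m1[of 4] degree(2) by simp
      finally show ?thesis .
    next
      case 2
      have "?nb i \<subseteq> {Suc m, m + 2 * s + 1} \<union> {j. adj m j}"
        using 2 m_pos by (auto elim!: ladder_adjE)
      then have "card (?nb i) \<le> card ({Suc m, m + 2 * s + 1} \<union> {j. adj m j})"
        using fin by (intro card_mono) auto
      also have "\<dots> \<le> card {Suc m, m + 2 * s + 1} + card {j. adj m j}" by (rule card_Un_le)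
      also have "\<dots> \<le> 2 + 2" using degree(3) by (intro add_mono) (auto simp: card_insert_if)
      finally show ?thesis by simp
    next
      case 3
      then have "?nb i \<subseteq> {j. adj i j}" using parcs_ladder_inner by blast
      then have "card (?nb i) \<le> card {j. adj i j}" using fin by (intro card_mono) auto
      then show ?thesis using degree(1)[of i] by simp
    next
      case 4
      \<comment> \<open>A ladder vertex sees its two neighbours on the cycle and possibly the vertex
        completing the constant endpoint sum of a rung.\<close>
      let ?next = "if i = m + 2 * s + 1 then 0 else Suc i"
      have "j \<in> {i - 1, ?next, 2 * m + 2 * s + 1 - i}" if "edge_adj (ladder_edges m s R) i j" for j
        using that by (cases rule: ladder_adjE) (use 4 in simp_all)
      then have "?nb i \<subseteq> {i - 1, ?next, 2 * m + 2 * s + 1 - i}"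
        using 4 adj_le[of i] by fastforce
      then have "card (?nb i) \<le> card {i - 1, ?next, 2 * m + 2 * s + 1 - i}"
        by (intro card_mono) auto
      also have "\<dots> \<le> 3" by (simp add: card_insert_if)
      finally show ?thesis by simp
    qed
  qed
  moreover have "card (?nb u) = 4"
  proof -
    have "0 < u" "u < m" using inner by auto
    then have "?nb u = {v, w, p, q}"
      using nbs(1) triangle spokes by (subst parcs_ladder_inner) auto
    then show ?thesis using distinct by simp
  qed
  moreover have "u \<in> pverts (ladder s R)" using inner by auto
  ultimately show ?thesis
    unfolding max_degree_def with_proj_simps by (intro Max_eqI) (auto simp: deg intro!: image_eqI[of _ _ u])
qed

section \<open>Two-colourings and odd cycles of the ladder graphs\<close>

text \<open>Colours alternate along the ladder, starting from \<open>h m\<close>. Path edges and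
  rungs have odd endpoint sum; the closing edge ends in a vertex coloured \<open>1 - h m\<close>,
  which suits 0 if \<open>h 0 = h m\<close> or 0 is deleted.\<close>

lemma ladder_colorable:
  assumes S: "S \<subseteq> {..<m}" and h: "\<And>i. h i < (2::nat)"
    and proper: "\<And>i j. adj i j \<Longrightarrow> i \<notin> S \<Longrightarrow> j \<notin> S \<Longrightarrow> h i \<noteq> h j" and "0 \<in> S \<or> h 0 = h m"
  shows "colorable (delete_verts (with_proj (ladder s R)) S) 2"
proof -
  interpret pair_graph "ladder s R" by (rule pair_graph_ladder)
  define d where "d i = (if i \<le> m then h i else if even (i - m) then h m else 1 - h m)" for i
  have d_tail: "d i = (if even (i - m) then h m else 1 - h m)" if "m \<le> i" for i
    using that by (auto simp: d_def)
  have flip: "1 - h m \<noteq> h m" using h[of m] by arith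
  have "d i < 2" for i using h[of i] h[of m] by (auto simp: d_def)
  moreover have d_neq: "d i \<noteq> d j" if ij: "m \<le> i" "m \<le> j" "i + j = 2 * l + 1" for i j l
  proof -
    have "even (i - m) \<noteq> even (j - m)" using ij by presburger
    then show ?thesis using ij flip by (auto simp: d_tail)
  qed
  have "d i \<noteq> d j" if ij: "edge_adj (ladder_edges m s R) i j" "i \<notin> S" "j \<notin> S" for i j
  proof -
    from ij(1) show ?thesis
    proof (cases rule: ladder_adjE)
      case 1
      then show ?thesis by (intro d_neq[of _ _ i]) auto
    next
      case 2
      then show ?thesis by (intro d_neq[of _ _ j]) auto
    next
      case 3
      then show ?thesis using assms(4) ij flip by (auto simp: d_def)
    next
      case 4
      then show ?thesis using assms(4) ij flip by (auto simp: d_def)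
    next
      case (5 k)
      then show ?thesis by (intro d_neq[of _ _ "m + s"]) auto
    next
      case (6 k)
      then show ?thesis by (intro d_neq[of _ _ "m + s"]) auto
    qed
  qed
  moreover have "d i \<noteq> d j" if "adj i j" "i \<notin> S" "j \<notin> S" for i j
    using adj_le[OF that(1)] proper[OF that] by (simp add: d_def)
  ultimately show ?thesis
    unfolding colorable_delete_verts_iff[OF pair_wf_digraph] by (intro exI[of _ d]) auto
qed

lemma ladder_colorable_pair: "colorable (delete_verts (with_proj (ladder s R)) {u, v}) 2"
  using inner distinct f by (intro ladder_colorable[of _ f]) auto

lemma ladder_colorable_triple: "colorable (delete_verts (with_proj (ladder s R)) {v, p, 0}) 2"
  using inner distinct g by (intro ladder_colorable[of _ g]) auto

text \<open>The triangle \<open>u v w\<close> puts one of its vertices into \<open>S\<close>. If it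
  is the only one, the other triangle on the opposite edge forces \<open>r\<close>, \<open>p\<close>
  or \<open>q\<close> into \<open>S\<close>, and a pentagon avoiding both of these vertices forces a
  third.\<close>

lemma ladder_odd_cycles:
  assumes "S \<subseteq> pverts (ladder s R)" "colorable (delete_verts (with_proj (ladder s R)) S) 2"
  shows "u \<in> S \<and> v \<in> S \<or> v \<in> S \<and> w \<in> S \<or> u \<in> S \<and> w \<in> S \<or> card S \<ge> 3"
proof -
  interpret pair_graph "ladder s R" by (rule pair_graph_ladder)
  obtain k where k: "\<forall>i \<in> pverts (ladder s R) - S. k i < (2::nat)"
    and "\<forall>i j. (i, j) \<in> parcs (ladder s R) \<longrightarrow> i \<notin> S \<longrightarrow> j \<notin> S \<longrightarrow> k i \<noteq> k j"
    using assms(2) unfolding colorable_delete_verts_iff[OF pair_wf_digraph] by blast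
  then have adj_k: "k i \<noteq> k j \<and> k i < 2 \<and> k j < 2" if "adj i j" "i \<notin> S" "j \<notin> S" for i j
    using that adj_le[OF that(1)] by auto
  have three: "i \<in> S \<or> j \<in> S \<or> l \<in> S" if "adj i j" "adj j l" "adj i l" for i j l
    using adj_k[OF that(1)] adj_k[OF that(2)] adj_k[OF that(3)] by linarith
  have five: "i \<in> S \<or> j \<in> S \<or> l \<in> S \<or> a \<in> S \<or> b \<in> S"
    if "adj i j" "adj j l" "adj l a" "adj a b" "adj b i" for i j l a b
    using adj_k[OF that(1)] adj_k[OF that(2)] adj_k[OF that(3)] adj_k[OF that(4)] adj_k[OF that(5)]
    by linarith
  have "finite S" using finite_subset[OF assms(1)] by simp
  then have card3: "card S \<ge> 3" if "{i, j, l} \<subseteq> S" "distinct [i, j, l]" for i j l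
    using card_mono[OF \<open>finite S\<close> that(1)] that(2) by simp
  consider "u \<in> S \<and> v \<in> S \<or> v \<in> S \<and> w \<in> S \<or> u \<in> S \<and> w \<in> S"
    | "u \<in> S" "v \<notin> S" "w \<notin> S" | "u \<notin> S" "v \<in> S" "w \<notin> S" | "u \<notin> S" "v \<notin> S" "w \<in> S"
    using three[OF triangle] by blast
  then show ?thesis
  proof cases
    case 2
    then have "r \<in> S" using three[of v w r] triangle spokes by blast
    moreover have "q \<in> S \<or> m \<in> S \<or> p \<in> S"
      using 2 five[of v q m p w] triangle spokes hexagon adj_sym by metis
    ultimately show ?thesis using card3[of u r] distinct inner 2 by auto
  next
    case 3
    then have "p \<in> S" using three[of u w p] triangle spokes by blast
    moreover have "q \<in> S \<or> 0 \<in> S \<or> r \<in> S"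
      using 3 five[of u q 0 r w] triangle spokes hexagon adj_sym by metis
    ultimately show ?thesis using card3[of v p] distinct inner 3 by auto
  next
    case 4
    then have "q \<in> S" using three[of u v q] triangle spokes by blast
    moreover have "p \<in> S \<or> c \<in> S \<or> r \<in> S"
      using 4 five[of u p c r v] triangle spokes hexagon adj_sym by metis
    ultimately show ?thesis using card3[of w q] distinct inner 4 by auto
  qed blast
qed

lemma ladder_in_S_graphs: "ladder s R \<in> S_graphs (m + 2 * s + 2)"
proof (rule S_graphsI[where A = "{u, v}" and B = "{v, p, 0}"])
  show "independent_verts (with_proj (ladder s R)) {v, p, 0}"
  proof -
    interpret pair_graph "ladder s R" by (rule pair_graph_ladder)
    have v: "\<not> adj v p" "\<not> adj v 0" "0 < v" "v < m"
      using nbs(2)[of p] nbs(2)[of 0] distinct inner by auto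
    have p: "\<not> adj p 0" "0 < p" "p < m" using not_adj inner by auto
    have "(v, p) \<notin> parcs (ladder s R)" "(p, v) \<notin> parcs (ladder s R)"
      "(v, 0) \<notin> parcs (ladder s R)" "(0, v) \<notin> parcs (ladder s R)"
      "(p, 0) \<notin> parcs (ladder s R)" "(0, p) \<notin> parcs (ladder s R)"
      using v p parcs_ladder_inner by blast+
    moreover have "(i, i) \<notin> parcs (ladder s R)" for i using pair_no_loops by fastforce
    ultimately show ?thesis
      using v p unfolding independent_verts_def by (auto simp del: parcs_ladder)
  qed
  show "card S \<ge> 2"
    if S: "S \<subseteq> pverts (ladder s R)" "colorable (delete_verts (with_proj (ladder s R)) S) 2" for S
  proof -
    have "finite S" using finite_subset[OF S(1)] by simp
    then have "card S \<ge> 2" if "{i, j} \<subseteq> S" "i \<noteq> j" for i j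
      using card_mono[OF \<open>finite S\<close> that(1)] that(2) by simp
    then show ?thesis using ladder_odd_cycles[OF S] distinct by auto
  qed
  show "card S \<ge> 3"
    if S: "independent_verts (with_proj (ladder s R)) S"
      "colorable (delete_verts (with_proj (ladder s R)) S) 2" for S
    \<comment> \<open>Any two of \<open>u\<close>, \<open>v\<close>, \<open>w\<close> are adjacent,
      so independence leaves only the last alternative.\<close>
    using ladder_odd_cycles[of S] S triangle unfolding independent_verts_def by auto
  show "{u, v} \<subseteq> pverts (ladder s R)" "card {u, v} = 2" "card {v, p, 0} = 3"
    using distinct inner by auto
qed (simp_all add: pair_graph_ladder max_degree_ladder ladder_colorable_pair ladder_colorable_triple)

section \<open>Connectivity and planarity of the ladder graphs\<close>

lemma ladder_2_connected: "k_connected 2 (with_proj (ladder s R))"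
proof (rule hamiltonian_imp_2_connected[OF pair_graph_ladder pverts_ladder])
  show "(i, Suc i) \<in> parcs (ladder s R)" if "Suc i < m + 2 * s + 2" for i
    using that by (cases "i < m") (auto simp: adj_def edge_adj_def ladder_edges_def)
  show "(0, m + 2 * s + 2 - 1) \<in> parcs (ladder s R)"
    by (simp add: edge_adj_def ladder_edges_def)
qed (use m_pos in simp)

text \<open>The whole ladder goes to the upper page. Rail steps join consecutive integers, the
  closing edge spans everything, rungs are nested, and the chords in \<open>U\<close> end no later
  than \<open>m\<close>, where the ladder begins.\<close>

lemma ladder_planar: "planar (with_proj (ladder s R))"
proof -
  interpret pair_graph "ladder s R" by (rule pair_graph_ladder)
  let ?U = "U \<union> {(i, Suc i) |i. i < m} \<union> ladder_edges m s R"
  have U: "(i, j) \<in> U \<and> i < j \<and> j \<le> m \<or> j = Suc i \<or> i = 0 \<and> j = m + 2 * s + 1 \<or>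
      m \<le> i \<and> i < j \<and> i + j = 2 * m + 2 * s + 1" if "(i, j) \<in> ?U" for i j
    using that chords rung_less by (fastforce simp: ladder_edges_def)
  have le: "j \<le> m + 2 * s + 1" if "(i, j) \<in> ?U" for i j
    using that chords by (fastforce simp: ladder_edges_def)
  have "noncrossing ?U"
    unfolding noncrossing_def
  proof clarify
    fix i j k l assume ij: "(i, j) \<in> ?U" and kl: "(k, l) \<in> ?U" and less: "i < k" "k < j" "j < l"
    have "\<not> ((i, j) \<in> U \<and> (k, l) \<in> U)"
      using noncrossing(1) less unfolding noncrossing_def by fast
    then show False using U[OF ij] U[OF kl] le[OF kl] less by linarith
  qed
  moreover have "i \<noteq> j \<and> (min i j, max i j) \<in> ?U \<union> D" if "i \<rightarrow>\<^bsub>with_proj (ladder s R)\<^esub> j" for i j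
  proof -
    have "(i, j) \<in> ?U \<union> D \<or> (j, i) \<in> ?U \<union> D"
      using that by (auto simp: adj_def edge_adj_def)
    then consider "(i, j) \<in> ?U \<union> D" "i < j" | "(j, i) \<in> ?U \<union> D" "j < i"
      using U[of i j] U[of j i] chords[of i j] chords[of j i] by fastforce
    then show ?thesis by cases (simp_all add: min_def max_def)
  qed
  ultimately show ?thesis
    using noncrossing(2) by (intro two_page_book_imp_planar[OF wf_digraph, where U = ?U and D = D]) blast+
qed

section \<open>Recovering the rungs from the balls around the triangles\<close>

text \<open>Deleting \<open>u\<close> and \<open>v\<close> leaves a bipartite graph, so every
  triangle contains one of them, and its other vertices are among the neighbours listed in
  \<open>nbs\<close>.\<close>

lemma triangle_verts_ladder: "triangle_verts (ladder s R) = {u, v, w, p, q, r}"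
proof (intro equalityI subsetI)
  interpret pair_graph "ladder s R" by (rule pair_graph_ladder)
  have uv: "0 < u" "u < m" "0 < v" "v < m" using distinct inner by auto
  fix i assume "i \<in> triangle_verts (ladder s R)"
  then obtain j k where ijk: "(i, j) \<in> parcs (ladder s R)" "(j, k) \<in> parcs (ladder s R)"
      "(k, i) \<in> parcs (ladder s R)"
    unfolding triangle_verts_def by blast
  obtain d where d: "\<forall>i \<in> pverts (ladder s R) - {u, v}. d i < (2::nat)"
    "\<forall>i j. (i, j) \<in> parcs (ladder s R) \<longrightarrow> i \<notin> {u, v} \<longrightarrow> j \<notin> {u, v} \<longrightarrow> d i \<noteq> d j"
    using ladder_colorable_pair unfolding colorable_delete_verts_iff[OF pair_wf_digraph] by blast
  have "i \<in> {u, v} \<or> j \<in> {u, v} \<or> k \<in> {u, v}"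
  proof (rule ccontr)
    assume *: "\<not> ?thesis"
    then have "d i < 2" "d j < 2" "d k < 2"
      using d(1) ijk wellformed' by blast+
    moreover have "d i \<noteq> d j" "d j \<noteq> d k" "d k \<noteq> d i" using * d(2) ijk by blast+
    ultimately show False by linarith
  qed
  moreover have "x \<in> {u, v, w, p, q, r}"
    if "(x, y) \<in> parcs (ladder s R) \<or> (y, x) \<in> parcs (ladder s R)" "y \<in> {u, v}" for x y
  proof -
    have "adj y x" using that uv parcs_ladder_inner by blast
    then show ?thesis using nbs that(2) by blast
  qed
  ultimately show "i \<in> {u, v, w, p, q, r}" using ijk by blast
next
  have tri: "a \<in> triangle_verts (ladder s R)" if "adj a b" "adj b d" "adj d a" for a b d
    using that unfolding triangle_verts_def by auto
  have "u \<in> triangle_verts (ladder s R)" "v \<in> triangle_verts (ladder s R)" "w \<in> triangle_verts (ladder s R)"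
    "p \<in> triangle_verts (ladder s R)" "q \<in> triangle_verts (ladder s R)" "r \<in> triangle_verts (ladder s R)"
    using tri[of u v w] tri[of v w u] tri[of w u v] tri[of p u w] tri[of q u v] tri[of r v w]
      triangle spokes adj_sym by metis+
  then show "i \<in> triangle_verts (ladder s R)" if "i \<in> {u, v, w, p, q, r}" for i
    using that by blast
qed

text \<open>One step from the triangles stays inside the core and reaches \<open>c\<close>, 0 and
  \<open>m\<close>. The second step covers the core by \<open>near\<close> and leaves it only
  through 0 and \<open>m\<close>, to \<open>m + 2 * s + 1\<close> and \<open>Suc m\<close>.\<close>

lemma triangle_ball_2_ladder:
  "triangle_ball 2 (ladder s R) = insert (m + 2 * s + 1) {..Suc m}"
proof -
  let ?T = "triangle_verts (ladder s R)"
  have T: "?T = {u, v, w, p, q, r}" by (rule triangle_verts_ladder)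
  have T_inner: "0 < i \<and> i < m" if "i \<in> ?T" for i
    using that distinct inner unfolding T by auto
  have "grow (ladder s R) ?T \<subseteq> {..m}"
  proof
    fix j assume "j \<in> grow (ladder s R) ?T"
    then show "j \<in> {..m}"
      using T_inner parcs_ladder_inner adj_le by (fastforce simp: grow_def simp del: parcs_ladder)
  qed
  moreover have "j \<in> insert (m + 2 * s + 1) {..Suc m}" if "i \<le> m" "(i, j) \<in> parcs (ladder s R)" for i j
  proof -
    consider "adj i j" | "edge_adj (ladder_edges m s R) i j" using \<open>(i, j) \<in> _\<close> by auto
    then show ?thesis
    proof cases
      case 1
      then show ?thesis using adj_le by fastforce
    next
      case 2
      then show ?thesis using \<open>i \<le> m\<close> by (cases rule: ladder_adjE) auto
    qed
  qed
  then have "grow (ladder s R) {..m} \<subseteq> insert (m + 2 * s + 1) {..Suc m}"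
    by (auto simp: grow_def simp del: parcs_ladder)
  moreover have "grow (ladder s R) X \<subseteq> grow (ladder s R) Y" if "X \<subseteq> Y" for X Y
    using that by (auto simp: grow_def)
  ultimately have "grow (ladder s R) (grow (ladder s R) ?T) \<subseteq> insert (m + 2 * s + 1) {..Suc m}"
    by blast
  moreover have step: "j \<in> grow (ladder s R) X" if "i \<in> X" "(i, j) \<in> parcs (ladder s R)" for i j X
    using that by (auto simp: grow_def)
  have grown: "{u, v, w, p, q, r, c, 0, m} \<subseteq> grow (ladder s R) ?T"
  proof -
    have "c \<in> grow (ladder s R) ?T" "0 \<in> grow (ladder s R) ?T" "m \<in> grow (ladder s R) ?T"
      using step[of p ?T c] step[of q ?T 0] step[of p ?T m] hexagon T by auto
    then show ?thesis unfolding T by (auto simp: grow_def)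
  qed
  have "insert (m + 2 * s + 1) {..Suc m} \<subseteq> grow (ladder s R) (grow (ladder s R) ?T)"
  proof
    fix i assume "i \<in> insert (m + 2 * s + 1) {..Suc m}"
    then have "i = m + 2 * s + 1 \<or> i = Suc m \<or> i \<le> m" by auto
    then have "i \<in> {u, v, w, p, q, r, c, 0, m} \<or>
        (\<exists>j \<in> {u, v, w, p, q, r, c, 0, m}. (j, i) \<in> parcs (ladder s R))"
    proof (elim disjE)
      assume "i \<le> m"
      then show ?thesis using near by fastforce
    qed (auto simp: edge_adj_def ladder_edges_def)
    then show "i \<in> grow (ladder s R) (grow (ladder s R) ?T)"
    proof
      assume "i \<in> {u, v, w, p, q, r, c, 0, m}"
      then show ?thesis using grown unfolding grow_def[of _ "grow _ _"] by blast
    next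
      assume "\<exists>j \<in> {u, v, w, p, q, r, c, 0, m}. (j, i) \<in> parcs (ladder s R)"
      then obtain j where "j \<in> {u, v, w, p, q, r, c, 0, m}" "(j, i) \<in> parcs (ladder s R)" by blast
      then show ?thesis using grown step by (meson subsetD)
    qed
  qed
  ultimately have "grow (ladder s R) (grow (ladder s R) ?T) = insert (m + 2 * s + 1) {..Suc m}"
    by (rule equalityI)
  then show ?thesis by (simp only: triangle_ball_def numeral_2_eq_2 funpow.simps comp_apply id_apply)
qed

text \<open>The set consists of the core and the levels up to \<open>k + 1\<close> of both rails. A
  rung changes the level by one, as a rail edge does, so exactly one level is added whichever rungs
  are present; \<open>Suc k < s\<close> keeps the two fronts apart.\<close>

lemma grow_ladder:
  assumes "Suc k < s"
  shows "grow (ladder s R) ({..m + k + 1} \<union> {m + 2 * s + 1 - k..m + 2 * s + 1}) =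
    {..m + Suc k + 1} \<union> {m + 2 * s + 1 - Suc k..m + 2 * s + 1}" (is "grow _ ?F = ?F'")
proof (intro equalityI subsetI)
  fix j assume "j \<in> grow (ladder s R) ?F"
  then consider "j \<in> ?F" | i where "i \<in> ?F" "adj i j"
    | i where "i \<in> ?F" "edge_adj (ladder_edges m s R) i j"
    unfolding grow_def using parcs_ladder by blast
  then show "j \<in> ?F'"
  proof cases
    case 1
    then show ?thesis by auto
  next
    case (2 i)
    then show ?thesis using adj_le[of i j] by simp
  next
    case (3 i)
    have i: "i \<le> m + k + 1 \<or> m + 2 * s + 1 \<le> i + k" using 3(1) by auto
    from 3(2) have "j \<le> m + k + 2 \<or> m + 2 * s \<le> j + k \<and> j \<le> m + 2 * s + 1"
      by (cases rule: ladder_adjE) (use i assms in auto)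
    then show ?thesis by auto
  qed
next
  fix j assume "j \<in> ?F'"
  then have "j \<in> ?F \<or> j = Suc (m + k + 1) \<or> Suc j = m + 2 * s + 1 - k"
    using assms by auto
  then show "j \<in> grow (ladder s R) ?F"
  proof (elim disjE)
    assume "j = Suc (m + k + 1)"
    then have "(m + k + 1, j) \<in> parcs (ladder s R)"
      using assms by (simp add: edge_adj_def ladder_edges_def)
    moreover have "m + k + 1 \<in> ?F" by simp
    ultimately show ?thesis unfolding grow_def by blast
  next
    assume j: "Suc j = m + 2 * s + 1 - k"
    then have "m \<le> j" "j < m + 2 * s + 1" using assms by linarith+
    then have "(Suc j, j) \<in> parcs (ladder s R)"
      by (simp add: edge_adj_def ladder_edges_def)
    moreover have "Suc j \<in> ?F" using j by simp
    ultimately show ?thesis unfolding grow_def by blast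
  qed (simp add: grow_def)
qed

text \<open>The right-hand side does not depend on \<open>R\<close>, so ladders of equal length have
  the same balls of these radii.\<close>

lemma triangle_ball_ladder:
  assumes "k < s"
  shows "triangle_ball (k + 2) (ladder s R) = {..m + k + 1} \<union> {m + 2 * s + 1 - k..m + 2 * s + 1}"
  using assms
proof (induction k)
  case 0
  show ?case using triangle_ball_2_ladder by (simp add: numeral_2_eq_2)
next
  case (Suc k)
  then have "grow (ladder s R) (triangle_ball (k + 2) (ladder s R)) =
      {..m + Suc k + 1} \<union> {m + 2 * s + 1 - Suc k..m + 2 * s + 1}"
    using grow_ladder[of k] by simp
  then show ?case by (simp add: triangle_ball_def)
qed

end

text \<open>Rung \<open>k\<close> joins levels \<open>k\<close> and \<open>k + 1\<close>, so this
  ball contains both its ends, but at most one end of any later rung. Inside the ball the two graphs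
  differ in rung \<open>k\<close> alone.\<close>

lemma ladder_ball_arcs_less:
  assumes R: "R \<subseteq> {..<s}" and R': "R' \<subseteq> {..<s}" and k: "k \<in> R" "k \<notin> R'"
    and agree: "\<And>l. l < k \<Longrightarrow> l \<in> R \<longleftrightarrow> l \<in> R'"
  shows "card (parcs (ladder s R') \<inter> triangle_ball (k + 2) (ladder s R') \<times> triangle_ball (k + 2) (ladder s R'))
       < card (parcs (ladder s R) \<inter> triangle_ball (k + 2) (ladder s R) \<times> triangle_ball (k + 2) (ladder s R))"
proof -
  interpret pair_graph "ladder s R" by (rule pair_graph_ladder[OF R])
  define F where "F = {..m + k + 1} \<union> {m + 2 * s + 1 - k..m + 2 * s + 1}"
  have "k < s" using k R by auto
  then have F: "triangle_ball (k + 2) (ladder s R) = F" "triangle_ball (k + 2) (ladder s R') = F"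
    unfolding F_def using triangle_ball_ladder R R' by blast+
  have rung: "l \<in> R" if "l \<in> R'" "m + l \<in> F" "m + 2 * s + 1 - l \<in> F" for l
  proof -
    have "l < s" using that R' by auto
    then have "l \<le> k" using that \<open>k < s\<close> unfolding F_def by auto
    then show ?thesis using that(1) k(2) agree by (cases "l = k") auto
  qed
  have "(i, j) \<in> parcs (ladder s R)" if "(i, j) \<in> parcs (ladder s R')" "i \<in> F" "j \<in> F" for i j
    using that rung by (auto simp: edge_adj_def ladder_edges_def)
  then have "parcs (ladder s R') \<inter> F \<times> F \<subseteq> parcs (ladder s R) \<inter> F \<times> F" by auto
  moreover have "(m + k, m + 2 * s + 1 - k) \<in> parcs (ladder s R) \<inter> F \<times> F"
    using k \<open>k < s\<close> by (auto simp: edge_adj_def ladder_edges_def F_def)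
  moreover have "\<not> adj (m + k) (m + 2 * s + 1 - k)"
    using adj_le[of "m + k" "m + 2 * s + 1 - k"] \<open>k < s\<close> by auto
  moreover have "\<not> edge_adj (ladder_edges m s R') (m + k) (m + 2 * s + 1 - k)"
    using k(2) \<open>k < s\<close> m_pos by (auto elim!: ladder_adjE[OF R'])
  ultimately have "parcs (ladder s R') \<inter> F \<times> F \<subset> parcs (ladder s R) \<inter> F \<times> F"
    using parcs_ladder by blast
  then show ?thesis
    unfolding F using pair_finite_arcs by (intro psubset_card_mono) auto
qed

text \<open>Assuming equal counts instead of an isomorphism lets the lemma yield both injectivity of
  \<open>ladder s\<close> and non-isomorphism. The least index where the rung sets differ gives
  unequal counts.\<close>

lemma ladder_inject:
  assumes R: "R \<subseteq> {..<s}" and R': "R' \<subseteq> {..<s}"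
    and card_eq: "\<And>k. card (parcs (ladder s R) \<inter> triangle_ball k (ladder s R) \<times> triangle_ball k (ladder s R)) =
      card (parcs (ladder s R') \<inter> triangle_ball k (ladder s R') \<times> triangle_ball k (ladder s R'))"
  shows "R = R'"
proof (rule ccontr)
  assume "R \<noteq> R'"
  then obtain l where "(l \<in> R) \<noteq> (l \<in> R')" by blast
  then obtain k where k: "(k \<in> R) \<noteq> (k \<in> R')" "\<And>l. l < k \<Longrightarrow> l \<in> R \<longleftrightarrow> l \<in> R'"
    using exists_least_iff[of "\<lambda>k. (k \<in> R) \<noteq> (k \<in> R')"] by blast
  show False
  proof (cases "k \<in> R")
    case True
    then show False using k ladder_ball_arcs_less[OF R R', of k] card_eq[of "k + 2"] by simp
  next
    case False
    then show False using k ladder_ball_arcs_less[OF R' R, of k] card_eq[of "k + 2"] by simp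
  qed
qed

lemma ladder_family:
  "\<exists>F :: nat pair_pre_digraph set. F \<subseteq> S_graphs (m + 2 * s + 2) \<and>
     (\<forall>G \<in> F. k_connected 2 (with_proj G) \<and> planar (with_proj G)) \<and>
     pairwise (\<lambda>G H. \<not> digraph_iso (with_proj G) (with_proj H)) F \<and> finite F \<and> card F = 2 ^ s"
proof (intro exI[of _ "ladder s ` Pow {..<s}"] conjI)
  have "inj_on (ladder s) (Pow {..<s})"
    by (rule inj_onI, rule ladder_inject) auto
  then show "card (ladder s ` Pow {..<s}) = 2 ^ s" by (simp add: card_image card_Pow)
  show "pairwise (\<lambda>G H. \<not> digraph_iso (with_proj G) (with_proj H)) (ladder s ` Pow {..<s})"
    unfolding pairwise_def using ladder_inject digraph_iso_card_triangle_ball by blast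
qed (use ladder_in_S_graphs ladder_2_connected ladder_planar in auto)

end

section \<open>Verification of the two concrete cores\<close>

text \<open>The locale assumptions quantify over all naturals. Here they become finite checks over
  explicit lists, suitable for evaluation; only the range conditions on \<open>f\<close> and
  \<open>g\<close> stay unbounded.\<close>

lemma stability_coreI:
  fixes m u v w p q r c :: nat and us ds :: "(nat \<times> nat) list"
  defines "es \<equiv> us @ ds @ map (\<lambda>i. (i, Suc i)) [0..<m]"
  assumes "\<forall>(i, j) \<in> set (us @ ds). i < j \<and> j \<le> m"
    and "noncrossing (set us)" "noncrossing (set ds)"
    and "distinct [u, v, w, p, q, r, c]" "\<forall>i \<in> set [u, v, w, p, q, r, c]. 0 < i \<and> i < m"
    and present: "\<forall>(i, j) \<in> set [(u, v), (v, w), (u, w), (u, p), (u, q), (v, q), (v, r), (w, r), (w, p),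
      (p, m), (q, m), (q, 0), (r, 0), (r, c), (p, c)]. (i, j) \<in> set es \<or> (j, i) \<in> set es"
    and edges: "\<forall>(i, j) \<in> set (es @ map prod.swap es). (i = u \<longrightarrow> j \<in> set [v, w, p, q]) \<and>
      (i = v \<longrightarrow> j \<in> set [u, w, q, r]) \<and> (i = p \<longrightarrow> j \<noteq> 0) \<and>
      (i \<in> set [u, v] \<or> j \<in> set [u, v] \<or> f i \<noteq> f j) \<and>
      (i \<in> set [v, p, 0] \<or> j \<in> set [v, p, 0] \<or> g i \<noteq> g j)"
    and near: "\<forall>i \<in> set [0..<Suc m]. i \<in> set [u, v, w, p, q, r, c, 0, m] \<or> (i, c) \<in> set es \<or> (c, i) \<in> set es"
    and degree: "\<forall>i \<in> set [0..<Suc m]. length (filter (\<lambda>e. fst e = i) (es @ map prod.swap es)) \<le>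
      (if i = 0 then 3 else if i = m then 2 else 4)"
    and "\<And>i. f i < 2" "f 0 = f m" "\<And>i. g i < 2"
  shows "stability_core m (set us) (set ds) u v w p q r c f g"
proof -
  interpret hamiltonian_core m "set us" "set ds" .
  let ?as = "es @ map prod.swap es"
  have adj: "adj i j \<longleftrightarrow> (i, j) \<in> set ?as" for i j
    unfolding adj_def edge_adj_def es_def by auto
  have es_le: "i \<le> m \<and> j \<le> m" if "(i, j) \<in> set es" for i j
  proof -
    have "(i, j) \<in> set (us @ ds) \<or> (\<exists>k < m. i = k \<and> j = Suc k)" using that by (auto simp: es_def)
    then show ?thesis
    proof
      assume "(i, j) \<in> set (us @ ds)"
      from bspec[OF assms(2) this] show ?thesis by simp
    qed auto
  qed
  have le: "i \<le> m" if "adj i j" for i j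
    using that es_le[of i j] es_le[of j i] unfolding adj by auto
  \<comment> \<open>Counting list entries may count a neighbour twice, which is harmless for an
    upper bound.\<close>
  have deg: "card {j. adj i j} \<le> length (filter (\<lambda>e. fst e = i) ?as)" for i
  proof -
    have "{j. (i, j) \<in> set xs} = snd ` set (filter (\<lambda>e. fst e = i) xs)" for xs :: "(nat \<times> nat) list"
      by (auto intro: rev_image_eqI)
    then have "{j. adj i j} = snd ` set (filter (\<lambda>e. fst e = i) ?as)"
      unfolding adj .
    then show ?thesis by (metis card_length length_map set_map)
  qed
  have deg_le: "card {j. adj i j} \<le> (if i = 0 then 3 else if i = m then 2 else 4)" for i
  proof (cases "i \<le> m")
    case True
    then have "i \<in> set [0..<Suc m]" by auto
    then show ?thesis using degree deg[of i] by (meson le_trans)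
  next
    case False
    then have "{j. adj i j} = {}" using le by blast
    then show ?thesis by (simp only: card.empty)
  qed
  have E: "(i = u \<longrightarrow> j \<in> set [v, w, p, q]) \<and>
      (i = v \<longrightarrow> j \<in> set [u, w, q, r]) \<and> (i = p \<longrightarrow> j \<noteq> 0) \<and>
      (i \<in> set [u, v] \<or> j \<in> set [u, v] \<or> f i \<noteq> f j) \<and>
      (i \<in> set [v, p, 0] \<or> j \<in> set [v, p, 0] \<or> g i \<noteq> g j)" if "adj i j" for i j
    using edges that unfolding adj by blast
  have P: "adj i j" if "(i, j) \<in> set [(u, v), (v, w), (u, w), (u, p), (u, q), (v, q), (v, r), (w, r), (w, p),
      (p, m), (q, m), (q, 0), (r, 0), (r, c), (p, c)]" for i j
    using bspec[OF present that] unfolding adj by auto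
  have m: "0 < m" using assms(6) by auto
  show ?thesis
  proof
    show "card {j. adj i j} \<le> 4" for i using deg_le[of i] by (simp split: if_splits)
    show "card {j. adj 0 j} \<le> 3" "card {j. adj m j} \<le> 2" using deg_le[of 0] deg_le[of m] m by simp_all
    show "i \<in> {u, v, w, p, q, r, c, 0, m} \<or> adj c i" if "i \<le> m" for i
    proof -
      have "i \<in> set [0..<Suc m]" using that by auto
      with near have "i \<in> set [u, v, w, p, q, r, c, 0, m] \<or> (i, c) \<in> set es \<or> (c, i) \<in> set es" by blast
      then show ?thesis unfolding adj by auto
    qed
    show "i \<in> {v, w, p, q}" if "adj u i" for i using E[OF that] by simp
    show "i \<in> {u, w, q, r}" if "adj v i" for i using E[OF that] by simp
    show "\<not> adj p 0" using E[of p 0] by blast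
    show "f i \<noteq> f j" if "adj i j" "i \<notin> {u, v}" "j \<notin> {u, v}" for i j using E[OF that(1)] that by simp
    show "g i \<noteq> g j" if "adj i j" "i \<notin> {v, p, 0}" "j \<notin> {v, p, 0}" for i j using E[OF that(1)] that by simp
    show "i < j \<and> j \<le> m" if "(i, j) \<in> set us \<union> set ds" for i j using assms(2) that by auto
    show "{u, v, w, p, q, r, c} \<subseteq> {0<..<m}" using assms(6) by simp
  qed (fact assms | rule P, simp)+
qed

text \<open>The path is \<open>b r c p w v u q a\<close>.\<close>

lemma stability_core_8:
  "stability_core 8 (set [(3, 8), (3, 6), (4, 6)]) (set [(0, 7), (5, 7), (1, 5), (1, 4)]) 6 5 4 3 7 1 2
     (\<lambda>i. of_bool (i \<in> set [0, 2, 4, 8])) (\<lambda>i. of_bool (i \<in> set [2, 4, 7]))"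
  by (rule stability_coreI) (code_simp | simp)+

text \<open>The path is \<open>b z c r v w p u q a\<close>, where \<open>z\<close> is the additional neighbour of \<open>b\<close> and \<open>c\<close>.\<close>

lemma stability_core_9:
  "stability_core 9 (set [(2, 6), (6, 9), (3, 5)]) (set [(0, 8), (0, 3), (4, 8), (4, 7), (5, 7)]) 7 4 5 6 8 3 2
     (\<lambda>i. of_bool (i \<in> set [0, 2, 5, 9])) (\<lambda>i. of_bool (i \<in> set [2, 5, 8]))"
  by (rule stability_coreI) (code_simp | simp)+

theorem theorem9:
  fixes n :: nat
  assumes "n \<ge> 11"
  shows "\<exists>F :: nat pair_pre_digraph set.
           F \<subseteq> S_graphs n \<and>
           (\<forall>G \<in> F. k_connected 2 (with_proj G) \<and> planar (with_proj G)) \<and>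
           pairwise (\<lambda>G H. \<not> digraph_iso (with_proj G) (with_proj H)) F \<and>
           finite F \<and> card F \<ge> 2 ^ ((n - 11) div 2)"
proof (cases "even n")
  case True
  \<comment> \<open>For even \<open>n\<close> the core with \<open>m = 8\<close> leaves room for one
    rung position more than required, since \<open>(n - 11) div 2 = s - 1\<close>.\<close>
  define s where "s = (n - 10) div 2"
  have "n = 8 + 2 * s + 2" "(n - 11) div 2 \<le> s"
    using True assms unfolding s_def by presburger+
  moreover from this have "(2::nat) ^ ((n - 11) div 2) \<le> 2 ^ s" by (intro power_increasing) auto
  ultimately show ?thesis
    using stability_core.ladder_family[OF stability_core_8, of s] by metis
next
  case False
  \<comment> \<open>For odd \<open>n\<close> the core with \<open>m = 9\<close> fits, and
    \<open>s\<close> is exactly the required exponent.\<close>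
  define s where "s = (n - 11) div 2"
  have "n = 9 + 2 * s + 2"
    using False assms unfolding s_def by presburger
  then show ?thesis
    using stability_core.ladder_family[OF stability_core_9, of s] unfolding s_def by (metis order_refl)
qed

end
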